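(* Let $B(z)$ be analytic at $z=0$ with $B(0)=1$, and let $r,n\in\mathbb{N}_0$ with $0\le r\le n$. Then for $x\in\mathbb{R}$, \[ \frac{P_n^{(r)}(B;x)}{r!}=\sum_{k=r}^{n}\binom{k}{r}s_B(n,k)x^{k-r}=\sum_{j=r}^{n}\binom{n}{j}s_B(j,r)P_{n-j}(B;x), \] \[ \frac{\Delta^rP_n(B;x)}{r!}=\sum_{k=r}^{n}\binom{k}{r}S_B(n,k)(x)_{k-r}=\sum_{j=r}^{n}\binom{n}{j}S_B(j,r)P_{n-j}(B;x). \] In particular, $\frac{P_n^{(r)}(B;0)}{r!}=s_B(n,r)$ and $\frac{\Delta^rP_n(B;0)}{r!}=S_B(n,r)$.
   Context: For $B$ analytic at $0$ with $B(0)=1$, $\log B(z)$ is the branch with $\log B(0)=0$ near $0$ and $(B(z))^x=\exp(x\log B(z))$. Potential polynomials: $\sum_{n\ge0}P_n(B;x)\frac{z^n}{n!}=(B(z))^x$; $P_n^{(r)}$ is the $r$-th derivative in $x$. $B$-Stirling numbers: $\frac{(\log B(z))^k}{k!}=\sum_{n\ge k}s_B(n,k)\frac{z^n}{n!}$, $\frac{(B(z)-1)^k}{k!}=\sum_{n\ge k}S_B(n,k)\frac{z^n}{n!}$. Forward differences: $\Delta^rf(x)=\sum_{j=0}^r\binom{r}{j}(-1)^{r-j}f(x+j)$. Falling factorial $(x)_k=x(x-1)\cdots(x-k+1)$, $(x)_0=1$. *)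

theory Defs
  imports "HOL-Complex_Analysis.Complex_Analysis"
begin

text \<open>The coefficients \<open>c\<^sub>n\<close> in \<open>f z = (\<Sum>n. c\<^sub>n * z ^ n / fact n)\<close> near \<open>0\<close>, for \<open>f\<close> analytic at \<open>0\<close>.\<close>

definition egf_coeff :: "(complex \<Rightarrow> complex) \<Rightarrow> nat \<Rightarrow> complex" where
  "egf_coeff f n = fact n * fps_nth (fps_expansion f 0) n"

text \<open>
  If \<open>B\<close> is analytic at \<open>0\<close> with \<open>B 0 = 1\<close>, then \<open>B z\<close> is close to \<open>1\<close> for \<open>z\<close> near \<open>0\<close>, so the
  branch of \<open>log B(z)\<close> near \<open>0\<close> with \<open>log B(0) = 0\<close> is the principal one. The coefficients below
  depend only on the germ at \<open>0\<close>.
\<close>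

definition log_branch :: "(complex \<Rightarrow> complex) \<Rightarrow> complex \<Rightarrow> complex" where
  "log_branch B z = Ln (B z)"

definition potential_poly :: "(complex \<Rightarrow> complex) \<Rightarrow> nat \<Rightarrow> real \<Rightarrow> complex" where
  "potential_poly B n x = egf_coeff (\<lambda>z. exp (of_real x * log_branch B z)) n"

definition stirling1_B :: "(complex \<Rightarrow> complex) \<Rightarrow> nat \<Rightarrow> nat \<Rightarrow> complex" where
  "stirling1_B B n k = egf_coeff (\<lambda>z. log_branch B z ^ k / fact k) n"

definition stirling2_B :: "(complex \<Rightarrow> complex) \<Rightarrow> nat \<Rightarrow> nat \<Rightarrow> complex" where
  "stirling2_B B n k = egf_coeff (\<lambda>z. (B z - 1) ^ k / fact k) n"

definition nth_vector_derivative :: "nat \<Rightarrow> (real \<Rightarrow> 'a::real_normed_vector) \<Rightarrow> real \<Rightarrow> 'a" where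
  "nth_vector_derivative r f = ((\<lambda>g t. vector_derivative g (at t)) ^^ r) f"

definition forward_diff :: "nat \<Rightarrow> (real \<Rightarrow> complex) \<Rightarrow> real \<Rightarrow> complex" where
  "forward_diff r f x = (\<Sum>j=0..r. of_nat (r choose j) * (-1) ^ (r - j) * f (x + real j))"

definition falling_factorial :: "real \<Rightarrow> nat \<Rightarrow> real" where
  "falling_factorial x k = (\<Prod>i<k. x - real i)"

text \<open>The generating functions that characterise the above coefficients.\<close>

lemma egf_coeff_sums:
  assumes "f analytic_on {0}"
  shows "\<forall>\<^sub>F z in nhds 0. (\<lambda>n. egf_coeff f n * z ^ n / fact n) sums f z"
proof -
  have e: "f has_fps_expansion fps_expansion f 0"
    by (rule analytic_at_imp_has_fps_expansion_0[OF assms])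
  let ?F = "fps_expansion f 0"
  have r: "fps_conv_radius ?F > 0" and ev: "\<forall>\<^sub>F z in nhds 0. eval_fps ?F z = f z"
    using e by (auto simp: has_fps_expansion_def)
  have "\<forall>\<^sub>F z in nhds 0. z \<in> eball 0 (fps_conv_radius ?F)"
    using r by (intro eventually_nhds_in_open) (auto simp: zero_ereal_def)
  with ev show ?thesis
  proof eventually_elim
    case (elim z)
    have "(\<lambda>n. fps_nth ?F n * z ^ n) sums eval_fps ?F z"
      using elim by (intro sums_eval_fps) (auto simp: in_eball_iff)
    thus ?case using elim by (simp add: egf_coeff_def)
  qed
qed

lemma
  assumes "B analytic_on {0}" "B 0 = 1"
  shows log_branch_analytic: "log_branch B analytic_on {0}"
    and log_branch_0: "log_branch B 0 = 0"
    and exp_log_branch: "\<forall>\<^sub>F z in nhds 0. exp (log_branch B z) = B z"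
proof -
  show "log_branch B analytic_on {0}"
    unfolding log_branch_def using assms by (intro analytic_intros) auto
  show "log_branch B 0 = 0"
    using assms by (simp add: log_branch_def)
  have "isCont B 0"
    using assms(1) by (rule analytic_at_imp_isCont)
  hence "filterlim B (nhds 1) (nhds 0)"
    using assms(2) tendsto_at_iff_tendsto_nhds[of B 0] unfolding isCont_def by simp
  hence "\<forall>\<^sub>F z in nhds 0. B z \<noteq> 0"
    by (rule tendsto_imp_eventually_ne) simp
  thus "\<forall>\<^sub>F z in nhds 0. exp (log_branch B z) = B z"
    by eventually_elim (simp add: log_branch_def)
qed

lemma
  assumes "B analytic_on {0}" "B 0 = 1"
  shows potential_poly_sums: "\<forall>\<^sub>F z in nhds 0.
          (\<lambda>n. potential_poly B n x * z ^ n / fact n) sums exp (of_real x * log_branch B z)"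
    and stirling1_B_sums: "\<forall>\<^sub>F z in nhds 0.
          (\<lambda>n. stirling1_B B n k * z ^ n / fact n) sums (log_branch B z ^ k / fact k)"
    and stirling2_B_sums: "\<forall>\<^sub>F z in nhds 0.
          (\<lambda>n. stirling2_B B n k * z ^ n / fact n) sums ((B z - 1) ^ k / fact k)"
proof -
  have L: "log_branch B analytic_on {0}"
    by (rule log_branch_analytic[OF assms])
  have "(\<lambda>z. exp (of_real x * log_branch B z)) analytic_on {0}"
    by (intro analytic_intros L)
  thus "\<forall>\<^sub>F z in nhds 0.
      (\<lambda>n. potential_poly B n x * z ^ n / fact n) sums exp (of_real x * log_branch B z)"
    unfolding potential_poly_def by (rule egf_coeff_sums)
  have "(\<lambda>z. log_branch B z ^ k / fact k) analytic_on {0}"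
    by (intro analytic_on_divide analytic_on_power analytic_on_const L) auto
  thus "\<forall>\<^sub>F z in nhds 0.
      (\<lambda>n. stirling1_B B n k * z ^ n / fact n) sums (log_branch B z ^ k / fact k)"
    unfolding stirling1_B_def by (rule egf_coeff_sums)
  have "(\<lambda>z. (B z - 1) ^ k / fact k) analytic_on {0}"
    by (intro analytic_on_divide analytic_on_power analytic_on_diff analytic_on_const assms) auto
  thus "\<forall>\<^sub>F z in nhds 0.
      (\<lambda>n. stirling2_B B n k * z ^ n / fact n) sums ((B z - 1) ^ k / fact k)"
    unfolding stirling2_B_def by (rule egf_coeff_sums)
qed

lemma egf_coeff_power_below:
  assumes "f analytic_on {0}" "f 0 = 0" "n < k"
  shows "egf_coeff (\<lambda>z. f z ^ k / fact k) n = 0"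
proof -
  let ?F = "fps_expansion f 0"
  have 1: "(\<lambda>z. f z ^ k / fact k) has_fps_expansion (?F ^ k * fps_const (inverse (fact k)))"
    unfolding divide_inverse
    by (intro fps_expansion_intros analytic_at_imp_has_fps_expansion_0 assms)
  have 2: "(\<lambda>z. f z ^ k / fact k) has_fps_expansion fps_expansion (\<lambda>z. f z ^ k / fact k) 0"
    by (intro analytic_at_imp_has_fps_expansion_0 analytic_on_divide analytic_on_power
        analytic_on_const assms) auto
  have 3: "fps_expansion (\<lambda>z. f z ^ k / fact k) 0 = ?F ^ k * fps_const (inverse (fact k))"
    using 1 2 fps_expansion_unique_complex by blast
  have "fps_nth ?F 0 = 0"
    using assms by (simp add: fps_expansion_def)
  hence "fps_nth (?F ^ k) n = 0"
    using assms(3) startsby_zero_power_prefix by blast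
  thus ?thesis
    unfolding egf_coeff_def 3 by simp
qed

lemma
  assumes "B analytic_on {0}" "B 0 = 1" "n < k"
  shows stirling1_B_below: "stirling1_B B n k = 0"
    and stirling2_B_below: "stirling2_B B n k = 0"
proof -
  show "stirling1_B B n k = 0"
    unfolding stirling1_B_def
    using egf_coeff_power_below[OF log_branch_analytic log_branch_0] assms by blast
  have "(\<lambda>z. B z - 1) analytic_on {0}"
    by (intro analytic_on_diff analytic_on_const assms)
  thus "stirling2_B B n k = 0"
    unfolding stirling2_B_def using assms egf_coeff_power_below[of "\<lambda>z. B z - 1"] by simp
qed

end

theory Submission
  imports Defs
begin

text \<open>
  Put \<open>L = log B\<close> and \<open>U = B - 1\<close>, both vanishing at \<open>0\<close>. The function \<open>B(z)\<^sup>x\<close> is at the same time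
  \<open>E\<^sub>x \<circ> L\<close> with \<open>E\<^sub>x(t) = exp (x t)\<close> and \<open>G\<^sub>x \<circ> U\<close> with \<open>G\<^sub>x(t) = (1 + t)\<^sup>x\<close>. Applying \<open>d\<^sup>r/dx\<^sup>r\<close> to
  \<open>E\<^sub>x(t)\<close>, or \<open>\<Delta>\<^sup>r\<close> to \<open>G\<^sub>x(t)\<close>, multiplies it by \<open>t\<^sup>r\<close>. Hence all quantities are coefficients of
  \<open>L\<^sup>r B\<^sup>x\<close> and \<open>U\<^sup>r B\<^sup>x\<close>; reading these as the substitutions of \<open>L\<close> into \<open>t\<^sup>r E\<^sub>x(t)\<close> and of \<open>U\<close>
  into \<open>t\<^sup>r G\<^sub>x(t)\<close> gives the first sums, reading them as Cauchy products the second sums.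
\<close>

definition fps_egf_nth :: "'a::semiring_char_0 fps \<Rightarrow> nat \<Rightarrow> 'a" where
  "fps_egf_nth F n = fact n * fps_nth F n"

text \<open>For \<open>F = (\<Sum>j\<ge>1. u\<^sub>j t\<^sup>j / j!)\<close> this is the partial Bell polynomial \<open>B\<^bsub>n,k\<^esub>(u\<^sub>1, u\<^sub>2, \<dots>)\<close>.\<close>

definition fps_partial_bell :: "'a::field_char_0 fps \<Rightarrow> nat \<Rightarrow> nat \<Rightarrow> 'a" where
  "fps_partial_bell F n k = fps_egf_nth (F ^ k) n / fact k"

lemma fps_egf_nth_mult:
  fixes F G :: "'a::{comm_semiring_1, semiring_char_0} fps"
  shows "fps_egf_nth (F * G) n =
           (\<Sum>j=0..n. of_nat (n choose j) * fps_egf_nth F j * fps_egf_nth G (n - j))"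
proof -
  have "fact n = of_nat (n choose j) * fact j * (fact (n - j) :: 'a)" if "j \<le> n" for j
    using arg_cong[OF binomial_fact_lemma[OF that], of "of_nat :: nat \<Rightarrow> 'a"]
    by (simp add: mult_ac)
  thus ?thesis
    by (auto simp: fps_egf_nth_def fps_mult_nth sum_distrib_left mult_ac intro!: sum.cong)
qed

lemma fps_egf_nth_exp: "fps_egf_nth (fps_exp (c :: 'a::field_char_0)) n = c ^ n"
  by (simp add: fps_egf_nth_def)

lemma fps_egf_nth_binomial:
  "fps_egf_nth (fps_binomial (of_real x)) n = of_real (falling_factorial x n)"
  by (simp add: fps_egf_nth_def gbinomial_prod_rev falling_factorial_def atLeast0LessThan)

lemma fps_egf_nth_X_power_mult:
  fixes G :: "'a::field_char_0 fps"
  shows "fps_egf_nth (fps_X ^ r * G) n = fact r * of_nat (n choose r) * fps_egf_nth G (n - r)"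
  by (simp add: fps_egf_nth_def fps_X_power_mult_nth binomial_fact binomial_eq_0)

lemma fps_egf_nth_compose:
  "fps_egf_nth (G oo F) n = (\<Sum>k=0..n. fps_partial_bell F n k * fps_egf_nth G k)"
  by (simp add: fps_egf_nth_def fps_partial_bell_def fps_compose_nth sum_distrib_left mult_ac)

lemma fps_partial_bell_eq_0:
  assumes "fps_nth F 0 = 0" and "n < k"
  shows "fps_partial_bell F n k = 0"
  using startsby_zero_power_prefix[OF assms(1)] assms(2)
  by (simp add: fps_partial_bell_def fps_egf_nth_def)

lemma fps_X_power_mult_compose:
  fixes F G :: "'a::idom fps"
  assumes "fps_nth F 0 = 0"
  shows "(fps_X ^ r * G) oo F = F ^ r * (G oo F)"
  using assms by (simp add: fps_compose_mult_distrib flip: fps_compose_power)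

lemma sum_fps_partial_bell_eq_compose:
  assumes "fps_nth F 0 = 0"
  shows "(\<Sum>k=r..n. of_nat (k choose r) * fps_partial_bell F n k * fps_egf_nth G (k - r)) =
           fps_egf_nth (F ^ r * (G oo F)) n / fact r"
proof -
  have "fps_egf_nth (F ^ r * (G oo F)) n =
      (\<Sum>k=0..n. fps_partial_bell F n k * fps_egf_nth (fps_X ^ r * G) k)"
    by (simp only: fps_egf_nth_compose flip: fps_X_power_mult_compose[OF assms])
  also have "\<dots> = (\<Sum>k=0..n. fact r *
      (of_nat (k choose r) * fps_partial_bell F n k * fps_egf_nth G (k - r)))"
    unfolding fps_egf_nth_X_power_mult by (simp only: mult_ac)
  also have "\<dots> = (\<Sum>k=r..n. fact r *
      (of_nat (k choose r) * fps_partial_bell F n k * fps_egf_nth G (k - r)))"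
    by (rule sum.mono_neutral_right) (auto simp: binomial_eq_0)
  finally show ?thesis
    by (simp flip: sum_distrib_left)
qed

lemma sum_fps_partial_bell_eq_mult:
  assumes "fps_nth F 0 = 0"
  shows "(\<Sum>j=r..n. of_nat (n choose j) * fps_partial_bell F j r * fps_egf_nth G (n - j)) =
           fps_egf_nth (F ^ r * G) n / fact r"
proof -
  have "fps_egf_nth (F ^ r * G) n / fact r =
      (\<Sum>j=0..n. of_nat (n choose j) * fps_partial_bell F j r * fps_egf_nth G (n - j))"
    by (simp add: fps_egf_nth_mult fps_partial_bell_def sum_divide_distrib)
  also have "\<dots> = (\<Sum>j=r..n. of_nat (n choose j) * fps_partial_bell F j r * fps_egf_nth G (n - j))"
    by (rule sum.mono_neutral_right) (auto simp: fps_partial_bell_eq_0[OF assms])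
  finally show ?thesis ..
qed

lemma DERIV_fps_nth_exp:
  fixes c :: "'a::real_normed_field"
  shows "((\<lambda>c. fps_nth (fps_exp c) n) has_field_derivative fps_nth (fps_X * fps_exp c) n)
           (at c within S)"
proof (cases n)
  case (Suc m)
  have "((\<lambda>c. c ^ Suc m / fact (Suc m)) has_field_derivative
      of_nat (Suc m) * c ^ m / fact (Suc m)) (at c within S)"
    using DERIV_cdivide[OF DERIV_power[OF DERIV_ident, of "Suc m"]]
    by (simp del: fact_Suc of_nat_Suc power_Suc)
  moreover have "fps_nth (fps_X * fps_exp c) n = of_nat (Suc m) * c ^ m / fact (Suc m)"
    by (simp add: Suc del: of_nat_Suc)
  ultimately show ?thesis
    by (simp add: Suc del: fact_Suc of_nat_Suc power_Suc)
qed simp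

lemma DERIV_fps_nth_mult_exp_compose:
  fixes F H :: "'a::real_normed_field fps"
  assumes "fps_nth F 0 = 0"
  shows "((\<lambda>c. fps_nth (H * (fps_exp c oo F)) n) has_field_derivative
           fps_nth (H * (F * (fps_exp c oo F))) n) (at c within S)"
proof -
  have "((\<lambda>c. fps_nth (fps_exp c oo F) m) has_field_derivative
      fps_nth ((fps_X * fps_exp c) oo F) m) (at c within S)" for m
    unfolding fps_compose_nth by (intro DERIV_sum DERIV_cmult_right DERIV_fps_nth_exp)
  moreover have "(fps_X * fps_exp c) oo F = F * (fps_exp c oo F)"
    using fps_X_power_mult_compose[OF assms, of 1] by simp
  ultimately show ?thesis
    unfolding fps_mult_nth[of H] by (intro DERIV_sum DERIV_cmult) simp
qed

lemma nth_vector_derivative_eqI: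
  assumes "g 0 = f"
    and "\<And>r x. (g r has_vector_derivative g (Suc r) x) (at x)"
  shows "nth_vector_derivative r f = g r"
proof (induction r)
  case 0
  show ?case
    using assms(1) by (simp add: nth_vector_derivative_def)
next
  case (Suc r)
  have "nth_vector_derivative (Suc r) f = (\<lambda>x. vector_derivative (g r) (at x))"
    using Suc by (simp add: nth_vector_derivative_def)
  also have "\<dots> = g (Suc r)"
    by (intro ext vector_derivative_at assms(2))
  finally show ?case .
qed

lemma nth_vector_derivative_fps_egf_nth_exp_compose:
  fixes F :: "'a::real_normed_field fps"
  assumes "fps_nth F 0 = 0"
  shows "nth_vector_derivative r (\<lambda>x. fps_egf_nth (fps_exp (of_real x) oo F) n) =
           (\<lambda>x. fps_egf_nth (F ^ r * (fps_exp (of_real x) oo F)) n)"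
proof (rule nth_vector_derivative_eqI)
  show "((\<lambda>x. fps_egf_nth (F ^ r * (fps_exp (of_real x) oo F)) n) has_vector_derivative
      fps_egf_nth (F ^ Suc r * (fps_exp (of_real x) oo F)) n) (at x)" for r x
    unfolding fps_egf_nth_def power_Suc2 mult.assoc
    by (intro has_vector_derivative_mult_right has_vector_derivative_real_field
        DERIV_fps_nth_mult_exp_compose assms)
qed simp

lemma fps_binomial_add_of_nat_compose:
  fixes F :: "'a::field_char_0 fps"
  assumes "fps_nth F 0 = 0"
  shows "fps_binomial (c + of_nat j) oo F = (1 + F) ^ j * (fps_binomial c oo F)"
proof -
  have "(1 + fps_X) ^ j oo F = (1 + F) ^ j"
    using assms by (simp add: fps_compose_add_distrib flip: fps_compose_power)
  thus ?thesis
    by (simp add: fps_binomial_add_mult fps_binomial_of_nat fps_compose_mult_distrib[OF assms]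
        mult.commute)
qed

lemma forward_diff_fps_egf_nth_binomial_compose:
  assumes "fps_nth F 0 = 0"
  shows "forward_diff r (\<lambda>x. fps_egf_nth (fps_binomial (of_real x) oo F) n) x =
           fps_egf_nth (F ^ r * (fps_binomial (of_real x) oo F)) n"
proof -
  let ?G = "fps_binomial (of_real x) oo F"
  have "F ^ r = ((1 + F) + (-1)) ^ r"
    by simp
  also have "\<dots> = (\<Sum>j=0..r. of_nat (r choose j) * (1 + F) ^ j * (-1) ^ (r - j))"
    unfolding binomial_ring atMost_atLeast0 ..
  also have "\<dots> = (\<Sum>j=0..r. fps_const (of_nat (r choose j) * (-1) ^ (r - j)) * (1 + F) ^ j)"
    by (simp add: fps_of_nat mult_ac
        flip: fps_const_mult fps_const_power fps_const_neg fps_const_1_eq_1)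
  finally have "F ^ r * ?G =
      (\<Sum>j=0..r. fps_const (of_nat (r choose j) * (-1) ^ (r - j)) * ((1 + F) ^ j * ?G))"
    by (simp only: sum_distrib_right mult.assoc)
  hence "fps_egf_nth (F ^ r * ?G) n =
      (\<Sum>j=0..r. of_nat (r choose j) * (-1) ^ (r - j) * fps_egf_nth ((1 + F) ^ j * ?G) n)"
    by (simp only: fps_egf_nth_def fps_sum_nth fps_mult_left_const_nth sum_distrib_left
        mult.left_commute[of "fact n"])
  thus ?thesis
    by (simp add: forward_diff_def fps_binomial_add_of_nat_compose[OF assms])
qed

lemma egf_coeff_eq_fps_egf_nth:
  "f has_fps_expansion F \<Longrightarrow> egf_coeff f n = fps_egf_nth F n"
  by (simp add: egf_coeff_def fps_egf_nth_def fps_expansion_eqI)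

lemma egf_coeff_power_divide_fact:
  assumes "f has_fps_expansion F"
  shows "egf_coeff (\<lambda>z. f z ^ k / fact k) n = fps_partial_bell F n k"
proof -
  have "(\<lambda>z. f z ^ k * inverse (fact k)) has_fps_expansion F ^ k * fps_const (inverse (fact k))"
    by (intro fps_expansion_intros assms)
  from egf_coeff_eq_fps_egf_nth[OF this] show ?thesis
    by (simp add: fps_partial_bell_def fps_egf_nth_def divide_inverse)
qed

locale normalized_analytic =
  fixes B :: "complex \<Rightarrow> complex"
  assumes analytic: "B analytic_on {0}" and at_0: "B 0 = 1"
begin

definition log_fps :: "complex fps" where
  "log_fps = fps_expansion (log_branch B) 0"

definition minus_one_fps :: "complex fps" where
  "minus_one_fps = fps_expansion (\<lambda>z. B z - 1) 0"

lemma has_fps_expansion_log_fps: "log_branch B has_fps_expansion log_fps"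
  unfolding log_fps_def
  by (intro analytic_at_imp_has_fps_expansion_0 log_branch_analytic analytic at_0)

lemma has_fps_expansion_minus_one_fps: "(\<lambda>z. B z - 1) has_fps_expansion minus_one_fps"
  unfolding minus_one_fps_def
  by (intro analytic_at_imp_has_fps_expansion_0 analytic_intros analytic)

lemma log_fps_nth_0: "fps_nth log_fps 0 = 0"
  by (simp add: log_fps_def fps_expansion_def log_branch_0 analytic at_0)

lemma minus_one_fps_nth_0: "fps_nth minus_one_fps 0 = 0"
  by (simp add: minus_one_fps_def fps_expansion_def at_0)

lemma stirling1_B_eq_partial_bell: "stirling1_B B = fps_partial_bell log_fps"
  unfolding stirling1_B_def by (intro ext egf_coeff_power_divide_fact has_fps_expansion_log_fps)

lemma stirling2_B_eq_partial_bell: "stirling2_B B = fps_partial_bell minus_one_fps"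
  unfolding stirling2_B_def
  by (intro ext egf_coeff_power_divide_fact has_fps_expansion_minus_one_fps)

lemma potential_poly_eq_exp_compose:
  "potential_poly B n = (\<lambda>x. fps_egf_nth (fps_exp (of_real x) oo log_fps) n)"
proof
  fix x
  have "((\<lambda>t. exp (of_real x * t)) \<circ> log_branch B) has_fps_expansion
      (fps_exp (of_real x) oo log_fps)"
    by (intro has_fps_expansion_compose has_fps_expansion_exp has_fps_expansion_log_fps
        log_fps_nth_0)
  thus "potential_poly B n x = fps_egf_nth (fps_exp (of_real x) oo log_fps) n"
    unfolding potential_poly_def by (intro egf_coeff_eq_fps_egf_nth) (simp add: o_def)
qed

lemma potential_poly_eq_binomial_compose:
  "potential_poly B n = (\<lambda>x. fps_egf_nth (fps_binomial (of_real x) oo minus_one_fps) n)"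
proof
  fix x
  have expansion: "((\<lambda>t. (1 + t) powr of_real x) \<circ> (\<lambda>z. B z - 1)) has_fps_expansion
      (fps_binomial (of_real x) oo minus_one_fps)"
    by (intro has_fps_expansion_compose has_fps_expansion_binomial_complex
        has_fps_expansion_minus_one_fps minus_one_fps_nth_0)
  have powr_eq: "\<forall>\<^sub>F z in nhds 0. ((\<lambda>t. (1 + t) powr of_real x) \<circ> (\<lambda>z. B z - 1)) z =
      exp (of_real x * log_branch B z)"
    using exp_log_branch[OF analytic at_0]
    by eventually_elim (auto simp: powr_def log_branch_def)
  have "(\<lambda>z. exp (of_real x * log_branch B z)) has_fps_expansion
      (fps_binomial (of_real x) oo minus_one_fps)"
    using expansion has_fps_expansion_cong[OF powr_eq refl] by simp
  thus "potential_poly B n x = fps_egf_nth (fps_binomial (of_real x) oo minus_one_fps) n"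
    unfolding potential_poly_def by (rule egf_coeff_eq_fps_egf_nth)
qed

lemma nth_vector_derivative_potential_poly:
  "nth_vector_derivative r (potential_poly B n) x =
     fps_egf_nth (log_fps ^ r * (fps_exp (of_real x) oo log_fps)) n"
  by (simp add: potential_poly_eq_exp_compose
      nth_vector_derivative_fps_egf_nth_exp_compose[OF log_fps_nth_0])

lemma forward_diff_potential_poly:
  "forward_diff r (potential_poly B n) x =
     fps_egf_nth (minus_one_fps ^ r * (fps_binomial (of_real x) oo minus_one_fps)) n"
  unfolding potential_poly_eq_binomial_compose
  by (rule forward_diff_fps_egf_nth_binomial_compose[OF minus_one_fps_nth_0])

lemma sum_stirling1_B_power:
  "(\<Sum>k=r..n. of_nat (k choose r) * stirling1_B B n k * of_real (x ^ (k - r))) =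
     nth_vector_derivative r (potential_poly B n) x / fact r"
  using sum_fps_partial_bell_eq_compose[OF log_fps_nth_0, of r n "fps_exp (of_real x)"]
  by (simp add: stirling1_B_eq_partial_bell nth_vector_derivative_potential_poly fps_egf_nth_exp)

lemma sum_stirling1_B_potential_poly:
  "(\<Sum>j=r..n. of_nat (n choose j) * stirling1_B B j r * potential_poly B (n - j) x) =
     nth_vector_derivative r (potential_poly B n) x / fact r"
  unfolding stirling1_B_eq_partial_bell nth_vector_derivative_potential_poly
  unfolding potential_poly_eq_exp_compose
  by (rule sum_fps_partial_bell_eq_mult[OF log_fps_nth_0])

lemma sum_stirling2_B_falling_factorial:
  "(\<Sum>k=r..n. of_nat (k choose r) * stirling2_B B n k * of_real (falling_factorial x (k - r))) =
     forward_diff r (potential_poly B n) x / fact r"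
  unfolding stirling2_B_eq_partial_bell forward_diff_potential_poly
  by (simp only: sum_fps_partial_bell_eq_compose[OF minus_one_fps_nth_0]
      flip: fps_egf_nth_binomial)

lemma sum_stirling2_B_potential_poly:
  "(\<Sum>j=r..n. of_nat (n choose j) * stirling2_B B j r * potential_poly B (n - j) x) =
     forward_diff r (potential_poly B n) x / fact r"
  unfolding stirling2_B_eq_partial_bell forward_diff_potential_poly
  unfolding potential_poly_eq_binomial_compose
  by (rule sum_fps_partial_bell_eq_mult[OF minus_one_fps_nth_0])

lemma nth_vector_derivative_potential_poly_0:
  "nth_vector_derivative r (potential_poly B n) 0 / fact r = stirling1_B B n r"
  by (simp add: nth_vector_derivative_potential_poly stirling1_B_eq_partial_bell
      fps_partial_bell_def)

lemma forward_diff_potential_poly_0: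
  "forward_diff r (potential_poly B n) 0 / fact r = stirling2_B B n r"
  by (simp add: forward_diff_potential_poly stirling2_B_eq_partial_bell fps_partial_bell_def)

end

theorem theorem4:
  fixes B :: "complex \<Rightarrow> complex" and r n :: nat and x :: real
  assumes "B analytic_on {0}" and "B 0 = 1" and "r \<le> n"
  shows
    "(nth_vector_derivative r (potential_poly B n) x / fact r
        = (\<Sum>k=r..n. of_nat (k choose r) * stirling1_B B n k * of_real (x ^ (k - r)))
      \<and> (\<Sum>k=r..n. of_nat (k choose r) * stirling1_B B n k * of_real (x ^ (k - r)))
        = (\<Sum>j=r..n. of_nat (n choose j) * stirling1_B B j r * potential_poly B (n - j) x))
     \<and> (forward_diff r (potential_poly B n) x / fact r
        = (\<Sum>k=r..n. of_nat (k choose r) * stirling2_B B n k * of_real (falling_factorial x (k - r)))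
      \<and> (\<Sum>k=r..n. of_nat (k choose r) * stirling2_B B n k * of_real (falling_factorial x (k - r)))
        = (\<Sum>j=r..n. of_nat (n choose j) * stirling2_B B j r * potential_poly B (n - j) x))
     \<and> nth_vector_derivative r (potential_poly B n) 0 / fact r = stirling1_B B n r
     \<and> forward_diff r (potential_poly B n) 0 / fact r = stirling2_B B n r"
proof -
  interpret normalized_analytic B
    using assms(1,2) by unfold_locales
  show ?thesis
    by (simp only: sum_stirling1_B_power sum_stirling1_B_potential_poly
        sum_stirling2_B_falling_factorial sum_stirling2_B_potential_poly
        nth_vector_derivative_potential_poly_0 forward_diff_potential_poly_0)
qed

end
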